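(* Let $\Gamma=\mathbb{Z}/4\mathbb{Z}\times\mathbb{Z}/4\mathbb{Z}$, with generators $(1,0)$ and $(0,1)$, let $A=\begin{pmatrix}0&1\\-1&0\end{pmatrix}\in SO_2(\mathbb{C})$, and let $I$ be the $2\times2$ identity matrix. For any $n\ge3$, the homomorphism $\rho_{2n}:\Gamma\to SO_{2n}(\mathbb{C})$ defined by $$\rho_{2n}(1,0)=A\oplus A\oplus I\oplus\bigoplus_{i=4}^nA,\qquad \rho_{2n}(0,1)=I\oplus A\oplus A\oplus\bigoplus_{i=4}^nA$$ satisfies $\det(\rho_{2n}(\gamma)-\rho_{2n}(\gamma)^t)=0$ for all $\gamma\in\Gamma$ and $\mathrm{pl}(\rho_{2n}(1,0),\rho_{2n}(0,1),\dots,\rho_{2n}(0,1))\ne0$ (where $\rho_{2n}(0,1)$ occurs $n-1$ times). Hence $\rho_{2n}$ gives a counterexample to element-conjugacy implying global conjugacy: there exists a semisimple representation $\rho':\Gamma\to SO_{2n}(\mathbb{C})$ which is element-conjugate but not globally conjugate to $\rho_{2n}$ in $SO_{2n}(\mathbb{C})$.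
   Context: $SO_{2n}(\mathbb{C})=\{B\in M_{2n}(\mathbb{C})\mid BB^t=I,\ \det B=1\}$, $B^t$ the transpose. The linearized Pfaffian $\mathrm{pl}(C_1,\dots,C_n)$ of $2n\times2n$ matrices is the coefficient of $t_1\cdots t_n$ in $\mathrm{pf}(t_1(C_1-C_1^t)+\dots+t_n(C_n-C_n^t))$, where $\mathrm{pf}$ is the Pfaffian of an antisymmetric matrix. $\oplus$ denotes block-diagonal sum. A representation is a group homomorphism $\Gamma\to SO_{2n}(\mathbb{C})$; it is semisimple if the Zariski closure of its image is reductive (automatic for finite $\Gamma$). Homomorphisms $\rho_1,\rho_2:\Gamma\to SO_{2n}(\mathbb{C})$ are globally conjugate if $\rho_1=h\rho_2h^{-1}$ for some $h\in SO_{2n}(\mathbb{C})$, and element-conjugate if for every $\gamma\in\Gamma$ there is $h_\gamma\in SO_{2n}(\mathbb{C})$ with $\rho_1(\gamma)=h_\gamma\rho_2(\gamma)h_\gamma^{-1}$. *)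

theory Defs
  imports
    "HOL-Algebra.Elementary_Groups"
    "HOL-Analysis.Abstract_Topology"
    "HOL-Library.Poly_Mapping"
    "Jordan_Normal_Form.Determinant"
begin

section \<open>The special orthogonal group\<close>

definition mat_group :: "nat \<Rightarrow> complex mat set \<Rightarrow> complex mat monoid" where
  "mat_group k G = \<lparr>carrier = G, monoid.mult = (*), one = 1\<^sub>m k\<rparr>"

definition SO :: "nat \<Rightarrow> complex mat monoid" where
  "SO k = mat_group k {B \<in> carrier_mat k k. B * B\<^sup>T = 1\<^sub>m k \<and> det B = 1}"


section \<open>Pfaffians\<close>

text \<open>
  The Pfaffian of an antisymmetric matrix of even size, over an arbitrary commutative ring.
  Each perfect matching of the index set is represented by the unique permutation that lists its
  pairs \<open>{p (2 i), p (2 i + 1)}\<close> with increasing entries and increasing minima.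
\<close>

definition pfaffian :: "'a::comm_ring_1 mat \<Rightarrow> 'a" where
  "pfaffian M =
    (\<Sum>p | p permutes {0..<dim_row M} \<and>
          (\<forall>i < dim_row M div 2. p (2 * i) < p (2 * i + 1)) \<and>
          (\<forall>i j. i < j \<and> j < dim_row M div 2 \<longrightarrow> p (2 * i) < p (2 * j)).
       signof p * (\<Prod>i < dim_row M div 2. M $$ (p (2 * i), p (2 * i + 1))))"

text \<open>
  Polynomials in \<open>t\<^sub>0, t\<^sub>1, \<dots>\<close>: a monomial is a finitely supported exponent function, a polynomial a
  finitely supported coefficient function on monomials.
\<close>

type_synonym cpoly = "(nat \<Rightarrow>\<^sub>0 nat) \<Rightarrow>\<^sub>0 complex"

definition var :: "nat \<Rightarrow> cpoly" where
  "var l = Poly_Mapping.single (Poly_Mapping.single l 1) 1"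

definition const :: "complex \<Rightarrow> cpoly" where
  "const c = Poly_Mapping.single 0 c"

text \<open>
  For a list \<open>Cs\<close> of \<open>n\<close> matrices of size \<open>2n\<close>, the coefficient of the product of the \<open>n\<close> variables
  in the Pfaffian of the generic linear combination of the \<open>C - C\<^sup>T\<close>.
\<close>

definition linearized_pfaffian :: "complex mat list \<Rightarrow> complex" where
  "linearized_pfaffian Cs =
    (let n = length Cs in
     Poly_Mapping.lookup
       (pfaffian (mat (2 * n) (2 * n) (\<lambda>(i, j).
          \<Sum>l<n. var l * const ((Cs ! l - (Cs ! l)\<^sup>T) $$ (i, j)))))
       (\<Sum>l<n. Poly_Mapping.single l 1))"


section \<open>Semisimple representations\<close>

inductive_set poly_fun :: "nat \<Rightarrow> (complex mat \<Rightarrow> complex) set" for k :: nat where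
  poly_const: "(\<lambda>M. c) \<in> poly_fun k"
| poly_entry: "i < k \<Longrightarrow> j < k \<Longrightarrow> (\<lambda>M. M $$ (i, j)) \<in> poly_fun k"
| poly_add: "f \<in> poly_fun k \<Longrightarrow> g \<in> poly_fun k \<Longrightarrow> (\<lambda>M. f M + g M) \<in> poly_fun k"
| poly_mult: "f \<in> poly_fun k \<Longrightarrow> g \<in> poly_fun k \<Longrightarrow> (\<lambda>M. f M * g M) \<in> poly_fun k"

text \<open>The Zariski topology on the space of \<open>k \<times> k\<close> matrices has the principal open sets as a basis.\<close>

definition zariski :: "nat \<Rightarrow> complex mat topology" where
  "zariski k = topology_generated_by {{M \<in> carrier_mat k k. f M \<noteq> 0} | f. f \<in> poly_fun k}"

definition unipotent :: "nat \<Rightarrow> complex mat \<Rightarrow> bool" where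
  "unipotent k u \<longleftrightarrow> u \<in> carrier_mat k k \<and> (\<exists>m. (u - 1\<^sub>m k) ^\<^sub>m m = 0\<^sub>m k k)"

text \<open>
  Reductive means that the unipotent radical is trivial; the group itself need not be connected.
\<close>

definition reductive :: "nat \<Rightarrow> complex mat set \<Rightarrow> bool" where
  "reductive k G \<longleftrightarrow>
     group (mat_group k G) \<and>
     (\<forall>U. U \<lhd> mat_group k G \<and> closedin (subtopology (zariski k) G) U \<and>
          connectedin (zariski k) U \<and> (\<forall>u\<in>U. unipotent k u) \<longrightarrow> U = {1\<^sub>m k})"

text \<open>
  The closure may be taken among all matrices, since \<open>SO k\<close> is Zariski closed there.
\<close>

definition semisimple_rep :: "nat \<Rightarrow> 'g monoid \<Rightarrow> ('g \<Rightarrow> complex mat) \<Rightarrow> bool" where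
  "semisimple_rep k \<Gamma> \<rho> \<longleftrightarrow>
     \<rho> \<in> hom \<Gamma> (SO k) \<and> reductive k (zariski k closure_of (\<rho> ` carrier \<Gamma>))"


section \<open>Conjugacy of homomorphisms\<close>

definition globally_conjugate ::
    "'g monoid \<Rightarrow> 'h monoid \<Rightarrow> ('g \<Rightarrow> 'h) \<Rightarrow> ('g \<Rightarrow> 'h) \<Rightarrow> bool" where
  "globally_conjugate \<Gamma> G \<rho>\<^sub>1 \<rho>\<^sub>2 \<longleftrightarrow>
     (\<exists>h \<in> carrier G. \<forall>\<gamma> \<in> carrier \<Gamma>. \<rho>\<^sub>1 \<gamma> = h \<otimes>\<^bsub>G\<^esub> \<rho>\<^sub>2 \<gamma> \<otimes>\<^bsub>G\<^esub> inv\<^bsub>G\<^esub> h)"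

definition element_conjugate ::
    "'g monoid \<Rightarrow> 'h monoid \<Rightarrow> ('g \<Rightarrow> 'h) \<Rightarrow> ('g \<Rightarrow> 'h) \<Rightarrow> bool" where
  "element_conjugate \<Gamma> G \<rho>\<^sub>1 \<rho>\<^sub>2 \<longleftrightarrow>
     (\<forall>\<gamma> \<in> carrier \<Gamma>. \<exists>h \<in> carrier G. \<rho>\<^sub>1 \<gamma> = h \<otimes>\<^bsub>G\<^esub> \<rho>\<^sub>2 \<gamma> \<otimes>\<^bsub>G\<^esub> inv\<^bsub>G\<^esub> h)"


section \<open>The representation\<close>

definition Z4_Z4 :: "(int \<times> int) monoid" where
  "Z4_Z4 = integer_mod_group 4 \<times>\<times> integer_mod_group 4"

definition J2 :: "complex mat" where
  "J2 = mat_of_rows_list 2 [[0, 1], [-1, 0]]"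

definition gen10 :: "nat \<Rightarrow> complex mat" where
  "gen10 n = diag_block_mat ([J2, J2, 1\<^sub>m 2] @ replicate (n - 3) J2)"

definition gen01 :: "nat \<Rightarrow> complex mat" where
  "gen01 n = diag_block_mat ([1\<^sub>m 2, J2, J2] @ replicate (n - 3) J2)"

end

theory Submission
  imports Defs "HOL-Analysis.T1_Spaces"
begin

text \<open>
  In block form \<open>\<rho>(a, b) = A\<^sup>a \<oplus> A\<^sup>a\<^sup>+\<^sup>b \<oplus> A\<^sup>b \<oplus> A\<^sup>a\<^sup>+\<^sup>b \<oplus> \<dots>\<close>. One of \<open>a\<close>, \<open>b\<close>, \<open>a + b\<close> is even, so some
  block of \<open>\<rho>(\<gamma>)\<close> is \<open>\<plusminus>I\<close>: this block contributes a zero factor to \<open>det (\<rho>(\<gamma>) - \<rho>(\<gamma>)\<^sup>T)\<close>, and the reflection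
  in it commutes with \<open>\<rho>(\<gamma>)\<close>. Hence conjugating \<open>\<rho>\<close> by a reflection \<open>H\<close> gives an element-conjugate
  representation. If it were globally conjugate, an orthogonal matrix \<open>g\<close> with \<open>det g = -1\<close> would commute
  with the image of \<open>\<rho>\<close> and therefore with the complex structure \<open>A \<oplus> \<dots> \<oplus> A\<close>, which forces
  \<open>det g = 1\<close>. The Pfaffian of a block-diagonal matrix is the product of its block entries, and all
  contributions to its multilinear coefficient are nonnegative.
\<close>

section \<open>Block-diagonal matrices\<close>

text \<open>The blocks are listed as images of labels \<open>x\<close> under \<open>F\<close>, with
  sizes \<open>d x\<close>. Two matrices over the same label list then have matching block
  structure, so products, sums and differences can be formed block by block.\<close>

lemma diag_block_mat_carrier:
  assumes "\<And>x. x \<in> set xs \<Longrightarrow> F x \<in> carrier_mat (d x) (d x)"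
  shows "diag_block_mat (map F xs) \<in> carrier_mat (sum_list (map d xs)) (sum_list (map d xs))"
  using assms by (induction xs) (auto simp: Let_def)

lemma diag_block_mat_Cons:
  assumes "F x \<in> carrier_mat (d x) (d x)" 
    and "\<And>y. y \<in> set xs \<Longrightarrow> F y \<in> carrier_mat (d y) (d y)"
  shows "diag_block_mat (map F (x # xs)) =
    four_block_mat (F x) (0\<^sub>m (d x) (sum_list (map d xs))) (0\<^sub>m (sum_list (map d xs)) (d x))
      (diag_block_mat (map F xs))"
  using diag_block_mat_carrier[of xs F d] assms by (auto simp: Let_def)

lemma diag_block_mat_mult:
  fixes F G :: "'b \<Rightarrow> 'a::semiring_0 mat"
  assumes "\<And>x. x \<in> set xs \<Longrightarrow> F x \<in> carrier_mat (d x) (d x)"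
    and "\<And>x. x \<in> set xs \<Longrightarrow> G x \<in> carrier_mat (d x) (d x)"
  shows "diag_block_mat (map F xs) * diag_block_mat (map G xs) =
    diag_block_mat (map (\<lambda>x. F x * G x) xs)"
  using assms
proof (induction xs)
  case Nil
  then show ?case by auto
next
  case (Cons x xs)
  let ?s = "sum_list (map d xs)"
  have F: "F x \<in> carrier_mat (d x) (d x)" and G: "G x \<in> carrier_mat (d x) (d x)"
    using Cons.prems by auto
  have DF: "diag_block_mat (map F xs) \<in> carrier_mat ?s ?s"
    and DG: "diag_block_mat (map G xs) \<in> carrier_mat ?s ?s"
    using Cons.prems by (auto intro!: diag_block_mat_carrier)
  have IH: "diag_block_mat (map F xs) * diag_block_mat (map G xs) =
    diag_block_mat (map (\<lambda>x. F x * G x) xs)"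
    using Cons by auto
  have "diag_block_mat (map F (x # xs)) * diag_block_mat (map G (x # xs)) =
    four_block_mat (F x * G x) (0\<^sub>m (d x) ?s) (0\<^sub>m ?s (d x))
      (diag_block_mat (map F xs) * diag_block_mat (map G xs))"
    using diag_block_mat_Cons[of F x d xs] diag_block_mat_Cons[of G x d xs] Cons.prems DF DG
      left_add_zero_mat right_mult_zero_mat[OF F] left_mult_zero_mat[OF G] mult_carrier_mat[OF F G]
    by (simp add: mult_four_block_mat[OF F _ _ DF G _ _ DG, of "0\<^sub>m (d x) ?s" "0\<^sub>m ?s (d x)"
          "0\<^sub>m (d x) ?s" "0\<^sub>m ?s (d x)"] del: diag_block_mat.simps)
  also have "\<dots> = diag_block_mat (map (\<lambda>x. F x * G x) (x # xs))"
    unfolding IH using Cons.prems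
    by (subst diag_block_mat_Cons[where d = d]) (auto intro: mult_carrier_mat)
  finally show ?case .
qed

lemma diag_block_mat_add:
  fixes F G :: "'b \<Rightarrow> 'a::monoid_add mat"
  assumes "\<And>x. x \<in> set xs \<Longrightarrow> F x \<in> carrier_mat (d x) (d x)"
    and "\<And>x. x \<in> set xs \<Longrightarrow> G x \<in> carrier_mat (d x) (d x)"
  shows "diag_block_mat (map F xs) + diag_block_mat (map G xs) =
    diag_block_mat (map (\<lambda>x. F x + G x) xs)"
  using assms
proof (induction xs)
  case Nil
  then show ?case by auto
next
  case (Cons x xs)
  let ?s = "sum_list (map d xs)"
  have "F x \<in> carrier_mat (d x) (d x)" "G x \<in> carrier_mat (d x) (d x)"
    using Cons.prems by auto
  moreover have "diag_block_mat (map F xs) \<in> carrier_mat ?s ?s"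
    "diag_block_mat (map G xs) \<in> carrier_mat ?s ?s"
    "diag_block_mat (map (\<lambda>x. F x + G x) xs) \<in> carrier_mat ?s ?s"
    using Cons.prems by (auto intro!: diag_block_mat_carrier)
  moreover have "diag_block_mat (map (\<lambda>x. F x + G x) xs) =
     diag_block_mat (map F xs) + diag_block_mat (map G xs)"
    using Cons by auto
  ultimately show ?case
    by (auto simp: Let_def intro!: eq_matI)
qed

lemma diag_block_mat_minus:
  fixes F G :: "'b \<Rightarrow> 'a::group_add mat"
  assumes "\<And>x. x \<in> set xs \<Longrightarrow> F x \<in> carrier_mat (d x) (d x)"
    and "\<And>x. x \<in> set xs \<Longrightarrow> G x \<in> carrier_mat (d x) (d x)"
  shows "diag_block_mat (map F xs) - diag_block_mat (map G xs) =
    diag_block_mat (map (\<lambda>x. F x - G x) xs)"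
  using assms
proof (induction xs)
  case Nil
  then show ?case by auto
next
  case (Cons x xs)
  let ?s = "sum_list (map d xs)"
  have "F x \<in> carrier_mat (d x) (d x)" "G x \<in> carrier_mat (d x) (d x)"
    using Cons.prems by auto
  moreover have "diag_block_mat (map F xs) \<in> carrier_mat ?s ?s"
    "diag_block_mat (map G xs) \<in> carrier_mat ?s ?s"
    "diag_block_mat (map (\<lambda>x. F x - G x) xs) \<in> carrier_mat ?s ?s"
    using Cons.prems by (auto intro!: diag_block_mat_carrier minus_carrier_mat)
  moreover have "diag_block_mat (map (\<lambda>x. F x - G x) xs) =
     diag_block_mat (map F xs) - diag_block_mat (map G xs)"
    using Cons by auto
  ultimately show ?case
    by (auto simp: Let_def intro!: eq_matI)
qed

lemma diag_block_mat_uminus: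
  fixes As :: "'a::group_add mat list"
  shows "- diag_block_mat As = diag_block_mat (map uminus As)"
proof (induction As)
  case (Cons A As)
  then show ?case by (auto simp: Let_def simp flip: Cons.IH intro!: eq_matI)
qed auto

lemma diag_block_mat_transpose:
  "(diag_block_mat As)\<^sup>T = diag_block_mat (map transpose_mat As)"
proof (induction As)
  case (Cons A As)
  have "dim_row (diag_block_mat (map transpose_mat As)) = dim_col (diag_block_mat As)"
    "dim_col (diag_block_mat (map transpose_mat As)) = dim_row (diag_block_mat As)"
    unfolding Cons.IH[symmetric] by auto
  then show ?case
    by (subst diag_block_mat.simps, unfold Let_def,
        subst transpose_four_block_mat[of _ "dim_row A" "dim_col A" _ "dim_col (diag_block_mat As)"
          _ "dim_row (diag_block_mat As)"])
      (auto simp: Let_def Cons.IH)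
qed (auto intro!: eq_matI)

lemma det_diag_block_mat:
  fixes F :: "'b \<Rightarrow> 'a::idom mat"
  assumes "\<And>x. x \<in> set xs \<Longrightarrow> F x \<in> carrier_mat (d x) (d x)"
  shows "det (diag_block_mat (map F xs)) = (\<Prod>x\<leftarrow>xs. det (F x))"
  using assms
proof (induction xs)
  case (Cons x xs)
  have "diag_block_mat (map F xs) \<in> carrier_mat (sum_list (map d xs)) (sum_list (map d xs))"
    using Cons.prems by (auto intro!: diag_block_mat_carrier)
  then show ?case using Cons
    by (subst diag_block_mat_Cons[where d = d])
      (auto simp: det_four_block_mat_upper_right_zero[of _ "d x" _ "sum_list (map d xs)"])
qed simp

text \<open>Splitting off the first block lowers every later index by \<open>d\<close> and its block
  number by one. This is the shift needed to apply the induction hypothesis to the remaining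
  blocks.\<close>

lemma index_diag_block_mat_upt:
  fixes F :: "nat \<Rightarrow> 'a::zero mat"
  assumes "\<And>x. x < n \<Longrightarrow> F x \<in> carrier_mat d d" "i < n * d" "j < n * d"
  shows "diag_block_mat (map F [0..<n]) $$ (i, j) =
    (if i div d = j div d then F (i div d) $$ (i mod d, j mod d) else 0)"
  using assms
proof (induction n arbitrary: F i j)
  case (Suc n)
  have d: "d > 0" using Suc.prems(2) by (cases d) auto
  have *: "diag_block_mat (map (F \<circ> Suc) [0..<n]) \<in>
    carrier_mat (sum_list (map (\<lambda>_. d) [0..<n])) (sum_list (map (\<lambda>_. d) [0..<n]))"
    using Suc.prems(1) by (intro diag_block_mat_carrier) auto
  have car: "diag_block_mat (map (F \<circ> Suc) [0..<n]) \<in> carrier_mat (n * d) (n * d)"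
    using * by (simp add: sum_list_triv)
  have F0: "F 0 \<in> carrier_mat d d"
    using Suc.prems(1) by simp
  have "[0..<Suc n] = 0 # map Suc [0..<n]"
    by (simp add: upt_conv_Cons map_Suc_upt del: upt_Suc)
  then have eq: "diag_block_mat (map F [0..<Suc n]) =
    four_block_mat (F 0) (0\<^sub>m d (n * d)) (0\<^sub>m (n * d) d) (diag_block_mat (map (F \<circ> Suc) [0..<n]))"
    using F0 car by (simp add: Let_def)
  have low: "k div d = 0 \<longleftrightarrow> k < d" for k
    using d by (simp add: div_eq_0_iff)
  have hi: "k div d = Suc ((k - d) div d)" "k mod d = (k - d) mod d" if "\<not> k < d" for k
    using that d by (simp_all add: div_if[of k] mod_if[of k])
  have IH: "diag_block_mat (map (F \<circ> Suc) [0..<n]) $$ (i - d, j - d) =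
    (if (i - d) div d = (j - d) div d then (F \<circ> Suc) ((i - d) div d) $$ ((i - d) mod d, (j - d) mod d) else 0)"
    if "\<not> i < d" "\<not> j < d"
    using Suc.prems that by (intro Suc.IH) auto
  show ?case
    unfolding eq using F0 car Suc.prems(2,3) low[of i] low[of j] IH hi[of i] hi[of j]
    by (cases "i < d"; cases "j < d") auto
qed simp

section \<open>The Zariski topology\<close>

lemma topspace_zariski: "topspace (zariski k) = carrier_mat k k"
proof -
  have "carrier_mat k k = {M \<in> carrier_mat k k. (\<lambda>_. 1 :: complex) M \<noteq> 0}"
    by simp
  then have "carrier_mat k k \<in> {{M \<in> carrier_mat k k. f M \<noteq> 0} | f. f \<in> poly_fun k}"
    by (intro CollectI exI[of _ "\<lambda>_. 1"] conjI poly_const)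
  then show ?thesis
    unfolding zariski_def topology_generated_by_topspace by (intro equalityI Union_least Union_upper) auto
qed

text \<open>Two distinct matrices differ in some entry. The polynomial that subtracts the value of
  \<open>N\<close> from that entry cuts out an open set containing \<open>M\<close> but not
  \<open>N\<close>.\<close>

lemma t1_space_zariski: "t1_space (zariski k)"
  unfolding t1_space_def topspace_zariski
proof (intro ballI impI)
  fix M N :: "complex mat"
  assume M: "M \<in> carrier_mat k k" and N: "N \<in> carrier_mat k k" and "M \<noteq> N"
  then obtain i j where ij: "i < k" "j < k" "M $$ (i, j) \<noteq> N $$ (i, j)"
    by (metis carrier_matD eq_matI)
  define f where "f = (\<lambda>L::complex mat. L $$ (i, j) + - N $$ (i, j))"
  have "f \<in> poly_fun k"
    unfolding f_def using ij by (intro poly_add poly_entry poly_const)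
  then have "openin (zariski k) {L \<in> carrier_mat k k. f L \<noteq> 0}"
    unfolding zariski_def by (intro topology_generated_by_Basis CollectI exI[of _ f] conjI refl)
  moreover have "M \<in> {L \<in> carrier_mat k k. f L \<noteq> 0}" "N \<notin> {L \<in> carrier_mat k k. f L \<noteq> 0}"
    using M ij by (simp_all add: f_def)
  ultimately show "\<exists>U. openin (zariski k) U \<and> M \<in> U \<and> N \<notin> U"
    by (intro exI conjI)
qed

text \<open>In a T1 space a finite set is discrete, so a connected subgroup has at most one point,
  which must be the identity.\<close>

lemma reductive_finite:
  assumes "finite G" "group (mat_group k G)" "G \<subseteq> carrier_mat k k"
  shows "reductive k G"
  unfolding reductive_def
proof (intro conjI allI impI assms(2), elim conjE)
  fix U assume U: "U \<lhd> mat_group k G" "connectedin (zariski k) U"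
  have sub: "subgroup U (mat_group k G)"
    using U(1) by (rule normal_imp_subgroup)
  have "U \<subseteq> G" and one: "1\<^sub>m k \<in> U"
    using subgroup.subset[OF sub] subgroup.one_closed[OF sub] by (simp_all add: mat_group_def)
  then have fin: "finite U" and sub: "U \<subseteq> topspace (zariski k)"
    using assms(1,3) finite_subset[of U G] by (simp_all add: topspace_zariski)
  have "subtopology (zariski k) U = discrete_topology U"
    using subtopology_eq_discrete_topology_finite[OF t1_space_zariski sub fin] .
  moreover have "connectedin (subtopology (zariski k) U) U"
    using U(2) by (simp add: connectedin_subtopology)
  ultimately obtain a where "U \<subseteq> {a}"
    by (simp add: connectedin_discrete_topology) blast
  with one show "U = {1\<^sub>m k}" by blast
qed

section \<open>Orthogonal groups\<close>

text \<open>
  The eigenprojections \<open>P, Q\<close> of \<open>J\<close> are exchanged by transposition. Hence \<open>g\<close> is the product of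
  \<open>A = g P + Q\<close> and \<open>B = P + g Q\<close>, where \<open>A\<close> is the inverse of \<open>B\<^sup>T\<close>.
\<close>
lemma commuting_orthogonal_det:
  fixes g J :: "complex mat"
  assumes g: "g \<in> carrier_mat k k" and J: "J \<in> carrier_mat k k"
    and orth: "g * g\<^sup>T = 1\<^sub>m k" and sq: "J * J = - 1\<^sub>m k" and anti: "J\<^sup>T = - J"
    and comm: "g * J = J * g"
  shows "det g = 1"
proof -
  define P where "P = (1/2) \<cdot>\<^sub>m 1\<^sub>m k - (\<i>/2) \<cdot>\<^sub>m J"
  define Q where "Q = (1/2) \<cdot>\<^sub>m 1\<^sub>m k + (\<i>/2) \<cdot>\<^sub>m J"
  note distrib = add_mult_distrib_mat[of _ k k _ _ k] mult_add_distrib_mat[of _ k k _ k]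
    minus_mult_distrib_mat[of _ k k _ _ k] mult_minus_distrib_mat[of _ k k _ k]
    mult_smult_assoc_mat[of _ k k _ k] mult_smult_distrib[of _ k k _ k] minus_carrier_mat
  have P: "P \<in> carrier_mat k k" and Q: "Q \<in> carrier_mat k k"
    using J by (auto simp: P_def Q_def minus_carrier_mat)
  have gP: "g * P = P * g" and gQ: "g * Q = Q * g"
    unfolding P_def Q_def using J g by (simp_all add: distrib comm)
  have PP: "P * P = P" 
    unfolding P_def using J by (simp add: distrib sq) (auto intro!: eq_matI simp: field_simps)
  have QQ: "Q * Q = Q"
    unfolding Q_def using J by (simp add: distrib sq) (auto intro!: eq_matI simp: field_simps)
  have PQ: "P * Q = 0\<^sub>m k k"
    unfolding P_def Q_def using J by (simp add: distrib sq) (auto intro!: eq_matI simp: field_simps)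
  have QP: "Q * P = 0\<^sub>m k k"
    unfolding P_def Q_def using J by (simp add: distrib sq) (auto intro!: eq_matI simp: field_simps)
  have sum: "P + Q = 1\<^sub>m k"
    unfolding P_def Q_def using J by (auto intro!: eq_matI)
  have skew: "J $$ (j, i) = - J $$ (i, j)" if "i < k" "j < k" for i j
    using arg_cong[OF anti, of "\<lambda>M. M $$ (i, j)"] J that by auto
  \<comment> \<open>Transposition fixes the identity and negates \<open>J\<close>, so it flips the
    sign that distinguishes \<open>P\<close> from \<open>Q\<close>.\<close>
  have PT: "P\<^sup>T = Q"
  proof (rule eq_matI)
    fix i j assume "i < dim_row Q" "j < dim_col Q"
    then show "P\<^sup>T $$ (i, j) = Q $$ (i, j)"
      using J Q skew[of i j] unfolding P_def Q_def by simp
  qed (use P Q in auto)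
  then have QT: "Q\<^sup>T = P" by auto
  define A where "A = g * P + Q"
  define B where "B = P + g * Q"
  have A: "A \<in> carrier_mat k k" and B: "B \<in> carrier_mat k k"
    using g P Q by (auto simp: A_def B_def)
  have gT: "g\<^sup>T \<in> carrier_mat k k" using g by simp
  note assoc = assoc_mult_mat[of _ k k _ k _ k]
  \<comment> \<open>Rewrite rules that bring \<open>P\<close> and \<open>Q\<close> to the front of a
    product, past \<open>g\<close>, where they collapse as idempotents or annihilate each
    other.\<close>
  have left: "P * (P * X) = P * X" "Q * (Q * X) = Q * X"
    "P * (Q * X) = 0\<^sub>m k k" "Q * (P * X) = 0\<^sub>m k k"
    "g * (P * X) = P * (g * X)" "g * (Q * X) = Q * (g * X)" if X: "X \<in> carrier_mat k k" for X
  proof -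
    show "P * (P * X) = P * X" unfolding assoc[OF P P X, symmetric] PP ..
    show "Q * (Q * X) = Q * X" unfolding assoc[OF Q Q X, symmetric] QQ ..
    show "P * (Q * X) = 0\<^sub>m k k" unfolding assoc[OF P Q X, symmetric] PQ using X by simp
    show "Q * (P * X) = 0\<^sub>m k k" unfolding assoc[OF Q P X, symmetric] QP using X by simp
    show "g * (P * X) = P * (g * X)" unfolding assoc[OF g P X, symmetric] gP by (rule assoc[OF P g X])
    show "g * (Q * X) = Q * (g * X)" unfolding assoc[OF g Q X, symmetric] gQ by (rule assoc[OF Q g X])
  qed
  note simps = distrib assoc left PP QQ PQ QP gP gQ
  have "A * B = P * g + Q * g"
    unfolding A_def B_def using g P Q by (simp add: simps)
  also have "\<dots> = g"
    using add_mult_distrib_mat[OF P Q g] sum g by simp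
  finally have AB: "A * B = g" .
  have BT: "B\<^sup>T = Q + P * g\<^sup>T"
    unfolding B_def using transpose_add[of P k k "g * Q"] transpose_mult[OF g Q] P Q g
    by (simp add: PT QT)
  \<comment> \<open>Multiplying out leaves \<open>g * P * g\<^sup>T + Q\<close>; since
    \<open>P\<close> commutes with \<open>g\<close>, orthogonality turns the first term into
    \<open>P\<close>.\<close>
  have "A * B\<^sup>T = P + Q"
    unfolding BT A_def using g P Q gT by (simp add: simps orth comm_add_mat[of Q k k P])
  then have "det A * det B = 1"
    using det_mult[OF A, of "B\<^sup>T"] B sum by (simp add: det_transpose)
  then show ?thesis
    using det_mult[OF A B] AB by simp
qed

section \<open>The group SO(k) and conjugation by orthogonal matrices\<close>

lemma carrier_SO: "carrier (SO k) = {B \<in> carrier_mat k k. B * B\<^sup>T = 1\<^sub>m k \<and> det B = 1}"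
  and mult_SO [simp]: "x \<otimes>\<^bsub>SO k\<^esub> y = x * y"
  and one_SO [simp]: "\<one>\<^bsub>SO k\<^esub> = 1\<^sub>m k"
  by (simp_all add: SO_def mat_group_def)

lemma orthogonal_left:
  fixes B :: "'a::field mat"
  assumes "B \<in> carrier_mat k k" "B * B\<^sup>T = 1\<^sub>m k"
  shows "B\<^sup>T * B = 1\<^sub>m k"
  using mat_mult_left_right_inverse[OF assms(1) _ assms(2)] assms(1) by simp

lemma orthogonal_mult:
  fixes A B :: "'a::field mat"
  assumes A: "A \<in> carrier_mat k k" "A * A\<^sup>T = 1\<^sub>m k" and B: "B \<in> carrier_mat k k" "B * B\<^sup>T = 1\<^sub>m k"
  shows "(A * B) * (A * B)\<^sup>T = 1\<^sub>m k"
proof -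
  have AT: "A\<^sup>T \<in> carrier_mat k k" and BT: "B\<^sup>T \<in> carrier_mat k k"
    using A B by auto
  have "(A * B) * (A * B)\<^sup>T = A * (B * (B\<^sup>T * A\<^sup>T))"
    unfolding transpose_mult[OF A(1) B(1)]
    by (rule assoc_mult_mat[OF A(1) B(1) mult_carrier_mat[OF BT AT]])
  also have "\<dots> = A * ((B * B\<^sup>T) * A\<^sup>T)"
    by (simp only: assoc_mult_mat[OF B(1) BT AT])
  finally show ?thesis
    using A AT B by simp
qed

lemma orthogonal_det_square:
  fixes B :: "'a::field mat"
  assumes "B \<in> carrier_mat k k" "B * B\<^sup>T = 1\<^sub>m k"
  shows "det B * det B = 1"
  using det_mult[of B k "B\<^sup>T"] assms by (simp add: det_transpose)

lemma group_SO: "group (SO k)"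
proof (rule groupI)
  fix x y z assume xyz: "x \<in> carrier (SO k)" "y \<in> carrier (SO k)" "z \<in> carrier (SO k)"
  then show "x \<otimes>\<^bsub>SO k\<^esub> y \<in> carrier (SO k)"
    by (auto simp: carrier_SO orthogonal_mult det_mult[of _ k])
  from xyz show "x \<otimes>\<^bsub>SO k\<^esub> y \<otimes>\<^bsub>SO k\<^esub> z = x \<otimes>\<^bsub>SO k\<^esub> (y \<otimes>\<^bsub>SO k\<^esub> z)"
    by (auto simp: carrier_SO)
next
  fix x assume x: "x \<in> carrier (SO k)"
  then show "\<one>\<^bsub>SO k\<^esub> \<otimes>\<^bsub>SO k\<^esub> x = x"
    by (auto simp: carrier_SO)
  show "\<exists>y\<in>carrier (SO k). y \<otimes>\<^bsub>SO k\<^esub> x = \<one>\<^bsub>SO k\<^esub>"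
    using x orthogonal_left[of x k] by (intro bexI[of _ "x\<^sup>T"]) (auto simp: carrier_SO det_transpose)
qed (simp add: carrier_SO)

lemma inv_SO: "B \<in> carrier (SO k) \<Longrightarrow> inv\<^bsub>SO k\<^esub> B = B\<^sup>T"
  using orthogonal_left[of B k]
  by (intro group.inv_equality[OF group_SO]) (auto simp: carrier_SO det_transpose)

lemma conj_orthogonal_mult:
  fixes H :: "'a::field mat"
  assumes "H \<in> carrier_mat k k" "H * H\<^sup>T = 1\<^sub>m k" "A \<in> carrier_mat k k" "B \<in> carrier_mat k k"
  shows "H * (A * B) * H\<^sup>T = (H * A * H\<^sup>T) * (H * B * H\<^sup>T)"
proof -
  have HT: "H\<^sup>T \<in> carrier_mat k k" using assms by simp
  note assoc = assoc_mult_mat[of _ k k _ k _ k]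
  have "(H * A * H\<^sup>T) * (H * B * H\<^sup>T) = H * (A * ((H\<^sup>T * H) * (B * H\<^sup>T)))"
    using assms HT by (simp add: assoc)
  also have "\<dots> = H * (A * B) * H\<^sup>T"
    unfolding orthogonal_left[OF assms(1,2)] using assms HT by (simp add: assoc)
  finally show ?thesis by simp
qed

text \<open>An orthogonal \<open>H\<close> may have determinant -1, but its determinant enters the
  conjugate twice and squares to 1. Hence conjugation by a reflection still maps SO(k) to
  itself.\<close>

lemma conj_orthogonal_SO:
  assumes H: "H \<in> carrier_mat k k" "H * H\<^sup>T = 1\<^sub>m k" and B: "B \<in> carrier (SO k)"
  shows "H * B * H\<^sup>T \<in> carrier (SO k)"
proof -
  have BT: "B \<in> carrier_mat k k" "B * B\<^sup>T = 1\<^sub>m k" "det B = 1" and HT: "H\<^sup>T \<in> carrier_mat k k"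
    using B H by (auto simp: carrier_SO)
  have "(H * B * H\<^sup>T) * (H * B * H\<^sup>T)\<^sup>T = 1\<^sub>m k"
    using H BT HT orthogonal_left[OF H]
    by (intro orthogonal_mult) (auto simp: orthogonal_mult)
  moreover have "det (H * B * H\<^sup>T) = 1"
    using H BT HT orthogonal_det_square[OF H]
    by (simp add: det_mult[of _ k] det_transpose)
  ultimately show ?thesis
    using H BT HT by (simp add: carrier_SO)
qed

lemma conj_orthogonal_hom:
  assumes H: "H \<in> carrier_mat k k" "H * H\<^sup>T = 1\<^sub>m k" and \<rho>: "\<rho> \<in> hom G (SO k)"
  shows "(\<lambda>x. H * \<rho> x * H\<^sup>T) \<in> hom G (SO k)"
proof (rule homI)
  fix x y assume xy: "x \<in> carrier G" "y \<in> carrier G"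
  then have SO: "\<rho> x \<in> carrier (SO k)" "\<rho> y \<in> carrier (SO k)"
    using \<rho> by (auto simp: hom_def)
  then show "H * \<rho> x * H\<^sup>T \<in> carrier (SO k)"
    by (intro conj_orthogonal_SO H)
  show "H * \<rho> (x \<otimes>\<^bsub>G\<^esub> y) * H\<^sup>T = H * \<rho> x * H\<^sup>T \<otimes>\<^bsub>SO k\<^esub> (H * \<rho> y * H\<^sup>T)"
    using conj_orthogonal_mult[OF H, of "\<rho> x" "\<rho> y"] SO hom_mult[OF \<rho> xy] by (simp add: carrier_SO)
qed

text \<open>The image is finite, hence closed in the T1 Zariski topology. The closure therefore adds
  nothing, and a finite group is reductive.\<close>

lemma semisimple_rep_finite:
  assumes "group G" "finite (carrier G)" "\<rho> \<in> hom G (SO k)"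
  shows "semisimple_rep k G \<rho>"
proof -
  let ?I = "\<rho> ` carrier G"
  interpret group_hom G "SO k" \<rho>
    using assms group_SO by (simp add: group_hom_def group_hom_axioms_def)
  have fin: "finite ?I" using assms by simp
  have sub: "?I \<subseteq> carrier_mat k k"
    using hom_closed by (auto simp: carrier_SO)
  have "closedin (zariski k) ?I"
    using t1_space_zariski fin sub by (simp add: t1_space_closedin_finite topspace_zariski)
  then have "zariski k closure_of ?I = ?I"
    by (simp add: closure_of_eq)
  moreover have "group (mat_group k ?I)"
    using subgroup.subgroup_is_group[OF img_is_subgroup group_SO] by (simp add: SO_def mat_group_def)
  ultimately show ?thesis
    using assms fin sub unfolding semisimple_rep_def by (simp add: reductive_finite)
qed

lemma hom_eq_on_generate:
  assumes "group G" "group H" "f \<in> hom G H" "g \<in> hom G H" "S \<subseteq> carrier G"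
    and "\<And>x. x \<in> S \<Longrightarrow> f x = g x" "x \<in> generate G S"
  shows "f x = g x"
proof -
  interpret f: group_hom G H f using assms by (simp add: group_hom_def group_hom_axioms_def)
  interpret g: group_hom G H g using assms by (simp add: group_hom_def group_hom_axioms_def)
  from assms(7) show ?thesis
  proof induction
    case (eng x y)
    then have "x \<in> carrier G" "y \<in> carrier G"
      using group.generate_in_carrier[OF assms(1,5)] by auto
    with eng show ?case by simp
  qed (use assms in auto)
qed

text \<open>The conjugator is \<open>H * C\<close>: the factor \<open>C\<close> drops out because it
  commutes with \<open>\<rho> \<gamma>\<close>, and the determinant condition puts the product in
  SO(k). Each \<open>\<gamma>\<close> may have its own \<open>C\<close>.\<close>

lemma element_conjugateI:
  fixes \<rho> :: "'g \<Rightarrow> complex mat"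
  assumes H: "H \<in> carrier_mat k k" "H * H\<^sup>T = 1\<^sub>m k" and \<rho>: "\<rho> \<in> hom G (SO k)"
    and comm: "\<And>\<gamma>. \<gamma> \<in> carrier G \<Longrightarrow> \<exists>C \<in> carrier_mat k k.
      C * C\<^sup>T = 1\<^sub>m k \<and> C * \<rho> \<gamma> = \<rho> \<gamma> * C \<and> det H * det C = 1"
  shows "element_conjugate G (SO k) (\<lambda>\<gamma>. H * \<rho> \<gamma> * H\<^sup>T) \<rho>"
  unfolding element_conjugate_def
proof
  fix \<gamma> assume \<gamma>: "\<gamma> \<in> carrier G"
  obtain C where C: "C \<in> carrier_mat k k" "C * C\<^sup>T = 1\<^sub>m k" "C * \<rho> \<gamma> = \<rho> \<gamma> * C" "det H * det C = 1"
    using comm[OF \<gamma>] by blast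
  have R: "\<rho> \<gamma> \<in> carrier_mat k k"
    using \<rho> \<gamma> by (auto simp: hom_def carrier_SO)
  have T: "H\<^sup>T \<in> carrier_mat k k" "C\<^sup>T \<in> carrier_mat k k" using H C by auto
  note assoc = assoc_mult_mat[of _ k k _ k _ k]
  have HC: "H * C \<in> carrier (SO k)"
    using H C orthogonal_mult[OF H C(1,2)] by (simp add: carrier_SO det_mult[of _ k])
  have "(H * C) * \<rho> \<gamma> * (H * C)\<^sup>T = H * ((C * \<rho> \<gamma>) * (C\<^sup>T * H\<^sup>T))"
    using H C(1) R T by (simp add: assoc transpose_mult[of _ k k _ k])
  also have "\<dots> = H * (\<rho> \<gamma> * ((C * C\<^sup>T) * H\<^sup>T))"
    unfolding C(3) using H C(1) R T by (simp add: assoc)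
  also have "\<dots> = H * \<rho> \<gamma> * H\<^sup>T"
    unfolding C(2) using H R T by (simp add: assoc)
  finally show "\<exists>h\<in>carrier (SO k). H * \<rho> \<gamma> * H\<^sup>T = h \<otimes>\<^bsub>SO k\<^esub> \<rho> \<gamma> \<otimes>\<^bsub>SO k\<^esub> inv\<^bsub>SO k\<^esub> h"
    using HC by (intro bexI[of _ "H * C"]) (simp_all add: inv_SO)
qed

text \<open>If \<open>h\<close> realises the global conjugacy, then \<open>H\<^sup>T * h\<close>
  commutes with the image and inherits the determinant of \<open>H\<close>, since \<open>h\<close>
  has determinant 1. A reflection \<open>H\<close> thus yields a commuting matrix of determinant
  -1.\<close>

lemma globally_conjugateD:
  fixes \<rho> :: "'g \<Rightarrow> complex mat"
  assumes H: "H \<in> carrier_mat k k" "H * H\<^sup>T = 1\<^sub>m k" and \<rho>: "\<rho> \<in> hom G (SO k)"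
    and conj: "globally_conjugate G (SO k) (\<lambda>\<gamma>. H * \<rho> \<gamma> * H\<^sup>T) \<rho>"
  obtains g where "g \<in> carrier_mat k k" "g * g\<^sup>T = 1\<^sub>m k" "det g = det H"
    "\<And>\<gamma>. \<gamma> \<in> carrier G \<Longrightarrow> g * \<rho> \<gamma> = \<rho> \<gamma> * g"
proof -
  obtain h where h: "h \<in> carrier (SO k)"
    and eq: "\<And>\<gamma>. \<gamma> \<in> carrier G \<Longrightarrow> H * \<rho> \<gamma> * H\<^sup>T = h * \<rho> \<gamma> * h\<^sup>T"
    using conj by (auto simp: globally_conjugate_def inv_SO)
  have h': "h \<in> carrier_mat k k" "h * h\<^sup>T = 1\<^sub>m k" "det h = 1"
    using h by (auto simp: carrier_SO)
  have T: "H\<^sup>T \<in> carrier_mat k k" "h\<^sup>T \<in> carrier_mat k k" using H h' by auto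
  note assoc = assoc_mult_mat[of _ k k _ k _ k]
  show thesis
  proof (rule that[of "H\<^sup>T * h"])
    show "H\<^sup>T * h \<in> carrier_mat k k" using T h' by simp
    show "(H\<^sup>T * h) * (H\<^sup>T * h)\<^sup>T = 1\<^sub>m k"
      using T h' orthogonal_left[OF H] by (intro orthogonal_mult) auto
    show "det (H\<^sup>T * h) = det H"
      using T h' H by (simp add: det_mult[of _ k] det_transpose)
    fix \<gamma> assume \<gamma>: "\<gamma> \<in> carrier G"
    have R: "\<rho> \<gamma> \<in> carrier_mat k k"
      using \<rho> \<gamma> by (auto simp: hom_def carrier_SO)
    have "(H\<^sup>T * h) * \<rho> \<gamma> = H\<^sup>T * (h * (\<rho> \<gamma> * (h\<^sup>T * h)))"
      unfolding orthogonal_left[OF h'(1,2)] using T h'(1) R by (simp add: assoc)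
    also have "\<dots> = H\<^sup>T * ((h * \<rho> \<gamma> * h\<^sup>T) * h)"
      using T h'(1) R by (simp add: assoc)
    also have "\<dots> = (H\<^sup>T * H) * (\<rho> \<gamma> * (H\<^sup>T * h))"
      unfolding eq[OF \<gamma>, symmetric] using T h'(1) R H(1) by (simp add: assoc)
    finally show "(H\<^sup>T * h) * \<rho> \<gamma> = \<rho> \<gamma> * (H\<^sup>T * h)"
      unfolding orthogonal_left[OF H] using T R h'(1) by simp
  qed
qed

section \<open>Pfaffians of block-diagonal matrices\<close>

text \<open>The map is squeezed from both sides: counting up from 0 gives
  \<open>j \<le> q j\<close>, and counting down from \<open>n - 1\<close> gives the reverse
  inequality.\<close>

lemma strict_mono_on_lessThan_self:
  fixes q :: "nat \<Rightarrow> nat"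
  assumes mono: "\<And>i j. i < j \<Longrightarrow> j < n \<Longrightarrow> q i < q j" and less: "\<And>i. i < n \<Longrightarrow> q i < n"
    and "i < n"
  shows "q i = i"
proof (rule antisym)
  have "j < n \<Longrightarrow> j \<le> q j" for j
  proof (induction j)
    case (Suc j)
    then show ?case using mono[of j "Suc j"] by simp
  qed simp
  then show "i \<le> q i" using \<open>i < n\<close> by blast
  have "j < n \<Longrightarrow> q (n - Suc j) \<le> n - Suc j" for j
  proof (induction j)
    case 0
    then show ?case using less[of "n - 1"] by simp
  next
    case (Suc j)
    then have "n - Suc (Suc j) < n - Suc j" "n - Suc j < n" by linarith+
    with Suc mono[of "n - Suc (Suc j)" "n - Suc j"] show ?case by linarith
  qed
  from this[of "n - Suc i"] show "q i \<le> i" using \<open>i < n\<close> by simp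
qed

text \<open>A nonzero term must pair indices within blocks. Each pair is then a whole block in
  increasing order, and the increasing minima leave only the identity permutation.\<close>

lemma pfaffian_block_diagonal:
  assumes M: "M \<in> carrier_mat (2 * n) (2 * n)"
    and zero: "\<And>i j. i < 2 * n \<Longrightarrow> j < 2 * n \<Longrightarrow> i div 2 \<noteq> j div 2 \<Longrightarrow> M $$ (i, j) = 0"
  shows "pfaffian M = (\<Prod>i<n. M $$ (2 * i, 2 * i + 1))"
proof -
  define S where "S = {p. p permutes {0..<2 * n} \<and> (\<forall>i<n. p (2 * i) < p (2 * i + 1)) \<and>
    (\<forall>i j. i < j \<and> j < n \<longrightarrow> p (2 * i) < p (2 * j))}"
  define t where "t p = signof p * (\<Prod>i<n. M $$ (p (2 * i), p (2 * i + 1)))" for p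
  have fin: "finite S"
    unfolding S_def by (rule finite_subset[OF _ finite_permutations[of "{0..<2 * n}"]]) auto
  have "t p = 0" if p: "p \<in> S" and "p \<noteq> id" for p
  proof (rule ccontr)
    assume "t p \<noteq> 0"
    then have "(\<Prod>i<n. M $$ (p (2 * i), p (2 * i + 1))) \<noteq> 0"
      by (auto simp: t_def)
    then have nz: "M $$ (p (2 * i), p (2 * i + 1)) \<noteq> 0" if "i < n" for i
      using that prod_zero[of "{..<n}" "\<lambda>i. M $$ (p (2 * i), p (2 * i + 1))"] by blast
    have perm: "p permutes {0..<2 * n}" and lt: "\<And>i. i < n \<Longrightarrow> p (2 * i) < p (2 * i + 1)"
      and mono: "\<And>i j. i < j \<Longrightarrow> j < n \<Longrightarrow> p (2 * i) < p (2 * j)"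
      using p unfolding S_def by auto
    have bd: "p i < 2 * n" if "i < 2 * n" for i
      using permutes_in_image[OF perm, of i] that by simp
    have same: "p (2 * i) div 2 = p (2 * i + 1) div 2" if "i < n" for i
    proof (rule ccontr)
      assume "p (2 * i) div 2 \<noteq> p (2 * i + 1) div 2"
      then have "M $$ (p (2 * i), p (2 * i + 1)) = 0"
        using that by (intro zero bd) simp_all
      with nz[OF that] show False by contradiction
    qed
    \<comment> \<open>Two numbers with the same quotient by 2, in increasing order, are an even
      number and its successor.\<close>
    have q: "p (2 * i) = 2 * (p (2 * i) div 2)" "p (2 * i + 1) = 2 * (p (2 * i) div 2) + 1"
      if "i < n" for i
      using lt[OF that] same[OF that] by presburger+
    have "p (2 * i) div 2 = i" if "i < n" for i
    proof (rule strict_mono_on_lessThan_self[OF _ _ that])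
      show "p (2 * i) div 2 < p (2 * j) div 2" if "i < j" "j < n" for i j
        using mono[OF that] q(1)[of i] q(1)[of j] that by linarith
      show "p (2 * i) div 2 < n" if "i < n" for i
        using bd[of "2 * i"] that by linarith
    qed
    with q have even_odd: "p (2 * i) = 2 * i" "p (2 * i + 1) = 2 * i + 1" if "i < n" for i
      using that by auto
    have "p k = k" for k
    proof (cases "k < 2 * n")
      case True
      then show ?thesis
        using even_odd[of "k div 2"] by (cases "even k") simp_all
    next
      case False
      then show ?thesis using permutes_not_in[OF perm] by simp
    qed
    with \<open>p \<noteq> id\<close> show False by auto
  qed
  moreover have "id \<in> S"
    unfolding S_def by (auto simp: permutes_id)
  ultimately have "sum t S = t id"
    using sum.mono_neutral_right[OF fin, of "{id}" t] by auto
  also have "\<dots> = (\<Prod>i<n. M $$ (2 * i, 2 * i + 1))"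
    by (simp add: t_def)
  finally show ?thesis
    using M unfolding pfaffian_def S_def t_def by simp
qed

section \<open>The multilinear coefficient of a block-diagonal Pfaffian\<close>

lemma var_mult_const: "var l * const c = Poly_Mapping.single (Poly_Mapping.single l 1) c"
  by (simp add: var_def const_def mult_single)

lemma prod_single:
  "(\<Prod>i\<in>A. Poly_Mapping.single (f i) (c i)) = Poly_Mapping.single (sum f A) (prod c A)"
  for f :: "'i \<Rightarrow> 'a::comm_monoid_add" and c :: "'i \<Rightarrow> 'b::comm_semiring_1"
  by (induction A rule: infinite_finite_induct) (auto simp: mult_single)

text \<open>Expanding the product of block entries gives one term for each assignment of a variable
  to every block. All coefficients are natural numbers, so nothing cancels, and the identity
  assignment makes the sum positive.\<close>

lemma linearized_pfaffian_block_diagonal_nonzero: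
  fixes c :: "nat \<Rightarrow> nat \<Rightarrow> nat"
  assumes n: "length Cs = n"
    and carrier: "\<And>l. l < n \<Longrightarrow> Cs ! l \<in> carrier_mat (2 * n) (2 * n)"
    and zero: "\<And>l i j. l < n \<Longrightarrow> i < 2 * n \<Longrightarrow> j < 2 * n \<Longrightarrow> i div 2 \<noteq> j div 2 \<Longrightarrow>
      (Cs ! l) $$ (i, j) = 0"
    and entry: "\<And>i l. i < n \<Longrightarrow> l < n \<Longrightarrow>
      (Cs ! l - (Cs ! l)\<^sup>T) $$ (2 * i, 2 * i + 1) = of_nat (c i l)"
    and pos: "\<And>i. i < n \<Longrightarrow> 0 < c i i"
  shows "linearized_pfaffian Cs \<noteq> 0"
proof -
  define M where "M = mat (2 * n) (2 * n) (\<lambda>(i, j).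
    \<Sum>l<n. var l * const ((Cs ! l - (Cs ! l)\<^sup>T) $$ (i, j)))"
  define m where "m = (\<Sum>l<n. Poly_Mapping.single l (1::nat))"
  define s where "s \<sigma> = (\<Sum>i<n. Poly_Mapping.single (\<sigma> i) (1::nat))" for \<sigma> :: "nat \<Rightarrow> nat"
  define E where "E = PiE {..<n} (\<lambda>_. {..<n})"
  define t where "t \<sigma> = (if s \<sigma> = m then \<Prod>i<n. c i (\<sigma> i) else 0)" for \<sigma>
  have M: "M \<in> carrier_mat (2 * n) (2 * n)" by (simp add: M_def)
  have "(Cs ! l - (Cs ! l)\<^sup>T) $$ (i, j) = 0" if "l < n" "i < 2 * n" "j < 2 * n" "i div 2 \<noteq> j div 2" for l i j
    using carrier[of l] zero[of l i j] zero[of l j i] that by auto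
  then have "M $$ (i, j) = 0" if "i < 2 * n" "j < 2 * n" "i div 2 \<noteq> j div 2" for i j
    using that by (simp add: M_def const_def)
  then have "pfaffian M = (\<Prod>i<n. M $$ (2 * i, 2 * i + 1))"
    by (rule pfaffian_block_diagonal[OF M])
  also have "\<dots> = (\<Prod>i<n. \<Sum>l<n. Poly_Mapping.single (Poly_Mapping.single l 1) (of_nat (c i l)))"
    by (auto intro!: prod.cong sum.cong simp: M_def entry[simplified] var_mult_const)
  also have "\<dots> = (\<Sum>\<sigma>\<in>E. Poly_Mapping.single (s \<sigma>) (of_nat (\<Prod>i<n. c i (\<sigma> i))))"
    unfolding E_def s_def by (subst prod_sum_PiE) (auto simp: prod_single)
  finally have "linearized_pfaffian Cs = of_nat (sum t E)"
    unfolding linearized_pfaffian_def n Let_def M_def[symmetric] m_def[symmetric]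
    by (auto simp: lookup_sum lookup_single t_def when_def intro!: sum.cong)
  \<comment> \<open>The assignments in \<open>E\<close> are extensional, so the identity has to be
    restricted to \<open>{..<n}\<close>. Its monomial is the required \<open>m\<close>.\<close>
  moreover have "t (\<lambda>i\<in>{..<n}. i) \<le> sum t E"
    by (rule member_le_sum) (auto simp: E_def intro: finite_PiE split: if_splits)
  moreover have "0 < t (\<lambda>i\<in>{..<n}. i)"
    using pos by (simp add: t_def s_def m_def)
  ultimately show ?thesis
    by (metis not_le of_nat_eq_0_iff)
qed

section \<open>Quarter turns\<close>

definition mat2 :: "'a \<Rightarrow> 'a \<Rightarrow> 'a \<Rightarrow> 'a \<Rightarrow> 'a mat" where
  "mat2 a b c d = mat 2 2 (\<lambda>(i, j). if i = 0 then if j = 0 then a else b else if j = 0 then c else d)"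

lemma mat2_carrier [simp]: "mat2 a b c d \<in> carrier_mat 2 2"
  by (simp add: mat2_def)

lemma mat2_mult:
  fixes a :: "'a::semiring_0"
  shows "mat2 a b c d * mat2 a' b' c' d' =
    mat2 (a * a' + b * c') (a * b' + b * d') (c * a' + d * c') (c * b' + d * d')"
proof -
  have "{0..<2::nat} = {0, 1}" by auto
  then show ?thesis
    by (intro eq_matI) (auto simp: mat2_def scalar_prod_def)
qed

lemma mat2_minus: "mat2 a b c d - mat2 a' b' c' d' = mat2 (a - a') (b - b') (c - c') (d - d')"
  and mat2_add: "mat2 a b c d + mat2 a' b' c' d' = mat2 (a + a') (b + b') (c + c') (d + d')"
  and mat2_uminus: "- mat2 a b c d = mat2 (- a) (- b) (- c) (- d)"
  for a b c d a' b' c' d' :: "'a::group_add"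
  by (rule eq_matI; simp add: mat2_def)+

lemma mat2_transpose: "(mat2 a b c d)\<^sup>T = mat2 a c b d"
  by (rule eq_matI) (simp_all add: mat2_def)

lemma mat2_one: "1\<^sub>m 2 = mat2 1 0 0 1"
  by (rule eq_matI) (auto simp: mat2_def)

lemma mat2_zero: "0\<^sub>m 2 2 = mat2 0 0 0 0"
  by (rule eq_matI) (auto simp: mat2_def)

lemma det_mat2: "det (mat2 a b c d) = a * d - b * c" for a :: "'a::comm_ring_1"
proof -
  have "{..<2::nat} = {0, 1}" by auto
  then show ?thesis
    by (subst laplace_expansion_row[of _ 2 0])
      (simp_all add: cofactor_def det_single mat_delete_def mat2_def)
qed

text \<open>
  \<open>turn e\<close> is \<open>A\<^sup>e\<close>. The trigonometric form is defined for negative \<open>e\<close> as well and makes the period 4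
  evident.
\<close>
definition turn :: "int \<Rightarrow> complex mat" where
  "turn e = (let \<theta> = pi / 2 * of_int e in
    mat2 (of_real (cos \<theta>)) (of_real (sin \<theta>)) (- of_real (sin \<theta>)) (of_real (cos \<theta>)))"

definition reflection :: "complex mat" where
  "reflection = mat2 1 0 0 (- 1)"

lemma turn_carrier [simp]: "turn e \<in> carrier_mat 2 2"
  and reflection_carrier [simp]: "reflection \<in> carrier_mat 2 2"
  by (simp_all add: turn_def Let_def reflection_def)

lemma turn_mult: "turn a * turn b = turn (a + b)"
proof -
  have "pi / 2 * of_int (a + b) = pi / 2 * of_int a + pi / 2 * of_int b"
    by (simp add: distrib_left)
  then show ?thesis
    by (simp only: turn_def Let_def mat2_mult cos_add sin_add) (simp add: algebra_simps)
qed

lemma turn_0: "turn 0 = 1\<^sub>m 2"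
  by (simp add: turn_def mat2_one)

lemma J2_mat2: "J2 = mat2 0 1 (- 1) 0"
  by (rule eq_matI) (auto simp: J2_def mat2_def mat_of_rows_list_def less_2_cases_iff)

lemma turn_1: "turn 1 = J2"
  by (simp add: turn_def J2_mat2)

lemma turn_2: "turn 2 = - 1\<^sub>m 2"
  by (simp add: turn_def mat2_one mat2_uminus)

lemma turn_transpose: "(turn e)\<^sup>T = turn (- e)"
  by (simp add: turn_def Let_def mat2_transpose)

lemma turn_mod_4: "turn (e mod 4) = turn e"
proof -
  have "of_int e = of_int (e mod 4) + 4 * (of_int (e div 4) :: real)"
    by (metis mult_div_mod_eq add.commute of_int_add of_int_mult of_int_numeral)
  then have "pi / 2 * of_int e = pi / 2 * of_int (e mod 4) + 2 * pi * of_int (e div 4)"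
    by (simp add: algebra_simps)
  then have "cos (pi / 2 * of_int e) = cos (pi / 2 * of_int (e mod 4))"
    "sin (pi / 2 * of_int e) = sin (pi / 2 * of_int (e mod 4))"
    by (simp_all only: cos_add sin_add cos_int_2pin sin_int_2pin mult_1_right mult_zero_right diff_zero add_0_right)
  then show ?thesis by (simp only: turn_def Let_def)
qed

lemma turn_cong: "a mod 4 = b mod 4 \<Longrightarrow> turn a = turn b"
  by (metis turn_mod_4)

lemma det_turn: "det (turn e) = 1"
proof -
  have "of_real (cos x) * of_real (cos x) + of_real (sin x) * of_real (sin x) = (1 :: complex)" for x
    by (metis of_real_1 of_real_add of_real_mult power2_eq_square sin_cos_squared_add2)
  then show ?thesis
    by (simp add: turn_def Let_def det_mat2)
qed

lemma det_reflection: "det reflection = -1"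
  by (simp add: reflection_def det_mat2)

lemma reflection_orthogonal: "reflection * reflection\<^sup>T = 1\<^sub>m 2"
  by (simp add: reflection_def mat2_transpose mat2_mult mat2_one)

text \<open>For even \<open>e\<close> the sine entries vanish, so \<open>turn e\<close> is diagonal:
  it is symmetric and commutes with the diagonal matrix \<open>reflection\<close>.\<close>

lemma turn_even:
  assumes "even e"
  shows "turn e - (turn e)\<^sup>T = 0\<^sub>m 2 2" "reflection * turn e = turn e * reflection"
proof -
  obtain m where "e = 2 * m" using assms by (rule evenE)
  then have "sin (pi / 2 * of_int e) = 0"
    by (simp add: sin_zero_iff_int2)
  then show "turn e - (turn e)\<^sup>T = 0\<^sub>m 2 2" "reflection * turn e = turn e * reflection"
    by (simp_all only: turn_def Let_def)
      (simp_all add: mat2_transpose mat2_minus mat2_zero reflection_def mat2_mult)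
qed

section \<open>The representation\<close>

abbreviation blocks :: "nat \<Rightarrow> (nat \<Rightarrow> 'a::zero mat) \<Rightarrow> 'a mat" where
  "blocks n F \<equiv> diag_block_mat (map F [0..<n])"

lemma blocks_carrier [simp]:
  assumes "\<And>i. F i \<in> carrier_mat 2 2"
  shows "blocks n F \<in> carrier_mat (2 * n) (2 * n)"
  using diag_block_mat_carrier[of "[0..<n]" F "\<lambda>_. 2"] assms by (simp add: sum_list_triv mult.commute)

lemma blocks_one: "blocks n (\<lambda>_. 1\<^sub>m 2) = 1\<^sub>m (2 * n)"
  using diag_block_one_mat[of "replicate n (1\<^sub>m 2)"] 
  by (simp add: sum_list_replicate map_replicate_const mult.commute)

lemma blocks_mult:
  fixes F G :: "nat \<Rightarrow> 'a::semiring_0 mat"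
  assumes "\<And>i. F i \<in> carrier_mat 2 2" "\<And>i. G i \<in> carrier_mat 2 2"
  shows "blocks n F * blocks n G = blocks n (\<lambda>i. F i * G i)"
  using assms by (intro diag_block_mat_mult[where d = "\<lambda>_. 2"])

lemma blocks_cong: "(\<And>i. i < n \<Longrightarrow> F i = G i) \<Longrightarrow> blocks n F = blocks n G"
  by (intro arg_cong[of _ _ diag_block_mat] map_cong) auto

lemma det_blocks:
  fixes F :: "nat \<Rightarrow> 'a::idom mat"
  assumes "\<And>i. F i \<in> carrier_mat 2 2"
  shows "det (blocks n F) = (\<Prod>i<n. det (F i))"
  using det_diag_block_mat[of "[0..<n]" F "\<lambda>_. 2"] assms
  by (simp add: prod.distinct_set_conv_list[symmetric] atLeast0LessThan)

text \<open>Block 1 and the blocks from 3 on are A in both generators, so the exponents add there;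
  block 0 sees only the first generator and block 2 only the second. Sums stay unreduced, as
  \<open>turn\<close> has period 4.\<close>

definition exponent :: "int \<times> int \<Rightarrow> nat \<Rightarrow> int" where
  "exponent \<gamma> i = (if i = 0 then fst \<gamma> else if i = 2 then snd \<gamma> else fst \<gamma> + snd \<gamma>)"

definition rho :: "nat \<Rightarrow> int \<times> int \<Rightarrow> complex mat" where
  "rho n \<gamma> = blocks n (\<lambda>i. turn (exponent \<gamma> i))"

definition block_reflection :: "nat \<Rightarrow> nat \<Rightarrow> complex mat" where
  "block_reflection n j = blocks n (\<lambda>i. if i = j then reflection else 1\<^sub>m 2)"

section \<open>The group Z/4 x Z/4 and its explicit homomorphism into SO(2n)\<close>

lemma carrier_Z4_Z4: "carrier Z4_Z4 = {0..<4} \<times> {0..<4}"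
  by (simp add: Z4_Z4_def carrier_integer_mod_group)

lemma mult_Z4_Z4: "(a, b) \<otimes>\<^bsub>Z4_Z4\<^esub> (c, d) = ((a + c) mod 4, (b + d) mod 4)"
  by (simp add: Z4_Z4_def)

lemma group_Z4_Z4: "group Z4_Z4"
  unfolding Z4_Z4_def by (intro DirProd_group group_integer_mod_group)

lemma generate_Z4_Z4: "generate Z4_Z4 {(1, 0), (0, 1)} = carrier Z4_Z4" (is "?G = _")
proof
  show "?G \<subseteq> carrier Z4_Z4"
    by (rule group.generate_incl[OF group_Z4_Z4]) (auto simp: carrier_Z4_Z4)
  \<comment> \<open>The induction runs over natural multiples of a generator, reduced modulo 4 at
    each stage; the second coordinate is then built up in the same way.\<close>
  have a: "(int a mod 4, 0) \<in> ?G" for a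
  proof (induction a)
    case 0
    have "\<one>\<^bsub>Z4_Z4\<^esub> \<in> ?G" by (rule generate.one)
    then show ?case by (simp add: Z4_Z4_def)
  next
    case (Suc a)
    have "(int a mod 4, 0) \<otimes>\<^bsub>Z4_Z4\<^esub> (1, 0) \<in> ?G"
      by (intro generate.eng Suc generate.incl) simp
    then show ?case by (simp add: mult_Z4_Z4 mod_simps add.commute)
  qed
  have "(int a mod 4, int b mod 4) \<in> ?G" for a b
  proof (induction b)
    case 0
    show ?case using a by simp
  next
    case (Suc b)
    have "(int a mod 4, int b mod 4) \<otimes>\<^bsub>Z4_Z4\<^esub> (0, 1) \<in> ?G"
      by (intro generate.eng Suc generate.incl) simp
    then show ?case by (simp add: mult_Z4_Z4 mod_simps add.commute)
  qed
  then have G: "(int a mod 4, int b mod 4) \<in> ?G" for a b .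
  show "carrier Z4_Z4 \<subseteq> ?G"
  proof
    fix \<gamma> assume "\<gamma> \<in> carrier Z4_Z4"
    then have "\<gamma> = (int (nat (fst \<gamma>)) mod 4, int (nat (snd \<gamma>)) mod 4)"
      by (auto simp: carrier_Z4_Z4)
    then show "\<gamma> \<in> ?G" by (metis G)
  qed
qed

lemma rho_carrier [simp]: "rho n \<gamma> \<in> carrier_mat (2 * n) (2 * n)"
  by (simp add: rho_def)

lemma rho_hom: "rho n \<in> hom Z4_Z4 (SO (2 * n))"
proof (rule homI)
  fix x :: "int \<times> int"
  have "rho n x * (rho n x)\<^sup>T = 1\<^sub>m (2 * n)"
    by (simp add: rho_def diag_block_mat_transpose comp_def turn_transpose blocks_mult turn_mult
      turn_0 blocks_one)
  moreover have "det (rho n x) = 1"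
    by (simp add: rho_def det_blocks det_turn)
  ultimately show "rho n x \<in> carrier (SO (2 * n))"
    by (simp add: carrier_SO)
next
  fix x y :: "int \<times> int"
  obtain a b c d where xy: "x = (a, b)" "y = (c, d)" by (cases x; cases y)
  \<comment> \<open>The exponents agree only modulo 4, because the group operation reduces each
    component.\<close>
  have "turn (exponent (x \<otimes>\<^bsub>Z4_Z4\<^esub> y) i) = turn (exponent x i + exponent y i)" for i
    by (rule turn_cong) (simp add: xy mult_Z4_Z4 exponent_def mod_simps, simp add: algebra_simps)
  then show "rho n (x \<otimes>\<^bsub>Z4_Z4\<^esub> y) = rho n x \<otimes>\<^bsub>SO (2 * n)\<^esub> rho n y"
    by (simp add: rho_def blocks_mult turn_mult)
qed

lemma rho_generators:
  assumes "n \<ge> 3"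
  shows "rho n (1, 0) = gen10 n" "rho n (0, 1) = gen01 n"
proof -
  define xs where "xs = [turn 1, turn 1, turn 0] @ replicate (n - 3) (turn 1)"
  have "map (\<lambda>i. turn (exponent (1, 0) i)) [0..<n] = [turn 1, turn 1, turn 0] @ replicate (n - 3) (turn 1)"
    "map (\<lambda>i. turn (exponent (0, 1) i)) [0..<n] = [turn 0, turn 1, turn 1] @ replicate (n - 3) (turn 1)"
    using assms by (auto intro!: nth_equalityI simp: exponent_def nth_append nth_Cons split: nat.splits)
  then show "rho n (1, 0) = gen10 n" "rho n (0, 1) = gen01 n"
    by (simp_all add: rho_def gen10_def gen01_def turn_0 turn_1 del: diag_block_mat.simps)
qed

section \<open>Reflections in one block, the vanishing determinant and the nonzero linearized
  Pfaffian\<close>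

lemma block_reflection:
  shows block_reflection_carrier: "block_reflection n j \<in> carrier_mat (2 * n) (2 * n)"
    and block_reflection_orthogonal:
      "block_reflection n j * (block_reflection n j)\<^sup>T = 1\<^sub>m (2 * n)"
    and det_block_reflection: "j < n \<Longrightarrow> det (block_reflection n j) = - 1"
    and block_reflection_commute: "even (exponent \<gamma> j) \<Longrightarrow>
      block_reflection n j * rho n \<gamma> = rho n \<gamma> * block_reflection n j"
proof -
  let ?F = "\<lambda>i. if i = j then reflection else 1\<^sub>m 2"
  have F: "?F i \<in> carrier_mat 2 2" for i by simp
  show "block_reflection n j \<in> carrier_mat (2 * n) (2 * n)"
    by (simp add: block_reflection_def)
  have "block_reflection n j * (block_reflection n j)\<^sup>T = blocks n (\<lambda>i. ?F i * (?F i)\<^sup>T)"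
    unfolding block_reflection_def diag_block_mat_transpose map_map comp_def
    by (rule blocks_mult) simp_all
  also have "\<dots> = blocks n (\<lambda>_. 1\<^sub>m 2)"
    by (rule blocks_cong) (simp add: reflection_orthogonal)
  finally show "block_reflection n j * (block_reflection n j)\<^sup>T = 1\<^sub>m (2 * n)"
    by (simp add: blocks_one)
  show "det (block_reflection n j) = - 1" if "j < n"
  proof -
    have "det (block_reflection n j) = (\<Prod>i<n. if i = j then - 1 else 1)"
      unfolding block_reflection_def
      by (subst det_blocks[OF F]) (intro prod.cong refl, simp add: det_reflection)
    with that show ?thesis by simp
  qed
  show "block_reflection n j * rho n \<gamma> = rho n \<gamma> * block_reflection n j" if "even (exponent \<gamma> j)"
    unfolding block_reflection_def rho_def
    by (subst (1 2) blocks_mult, simp_all, intro blocks_cong) (auto simp: turn_even(2)[OF that]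
        left_mult_one_mat[OF turn_carrier] right_mult_one_mat[OF turn_carrier])
qed

lemma even_exponent: "\<exists>j<3. even (exponent \<gamma> j)"
proof (rule ccontr)
  assume "\<not> ?thesis"
  then have "odd (exponent \<gamma> 0)" "odd (exponent \<gamma> 1)" "odd (exponent \<gamma> 2)" by auto
  then show False by (simp add: exponent_def)
qed

lemma det_rho_minus_transpose:
  assumes "n \<ge> 3"
  shows "det (rho n \<gamma> - (rho n \<gamma>)\<^sup>T) = 0"
proof -
  obtain j where j: "j < 3" "even (exponent \<gamma> j)" using even_exponent by blast
  have "rho n \<gamma> - (rho n \<gamma>)\<^sup>T =
    blocks n (\<lambda>i. turn (exponent \<gamma> i) - (turn (exponent \<gamma> i))\<^sup>T)"
    unfolding rho_def diag_block_mat_transpose map_map comp_def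
    by (rule diag_block_mat_minus[where d = "\<lambda>_. 2"]) simp_all
  also have "det \<dots> = (\<Prod>i<n. det (turn (exponent \<gamma> i) - (turn (exponent \<gamma> i))\<^sup>T))"
    by (rule det_blocks) (simp add: minus_carrier_mat)
  also have "\<dots> = 0"
    using j assms turn_even(1)[OF j(2)] by (intro prod_zero bexI[of _ j]) (simp_all add: mat2_zero det_mat2)
  finally show ?thesis .
qed

lemma linearized_pfaffian_rho:
  assumes "n \<ge> 3"
  shows "linearized_pfaffian (rho n (1, 0) # replicate (n - 1) (rho n (0, 1))) \<noteq> 0"
proof -
  \<comment> \<open>The group element behind argument \<open>l\<close>. Assigning argument
    \<open>i\<close> to block \<open>i\<close> puts exponent 1 in every block: block 0 from (1, 0),
    all later blocks from (0, 1).\<close>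
  define e :: "nat \<Rightarrow> int \<times> int" where "e l = (if l = 0 then (1, 0) else (0, 1))" for l
  let ?Cs = "rho n (1, 0) # replicate (n - 1) (rho n (0, 1))"
  have nth: "?Cs ! l = rho n (e l)" if "l < n" for l
    using that by (cases l) (auto simp: e_def)
  have index: "rho n \<gamma> $$ (i, j) =
      (if i div 2 = j div 2 then turn (exponent \<gamma> (i div 2)) $$ (i mod 2, j mod 2) else 0)"
    if "i < 2 * n" "j < 2 * n" for \<gamma> i j
    unfolding rho_def using that by (intro index_diag_block_mat_upt) (simp_all add: mult.commute)
  \<comment> \<open>The exponents of the generators are 0 or 1, and the sine of that many quarter
    turns is the same number. Twice this sine is the upper off-diagonal entry of a block minus its
    transpose.\<close>
  have sin: "(if exponent (e l) i = 1 then 1 else 0) = sin (pi / 2 * of_int (exponent (e l) i))" for l i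
    by (auto simp: exponent_def e_def)
  show ?thesis
  proof (rule linearized_pfaffian_block_diagonal_nonzero)
    show "length ?Cs = n" using assms by simp
    show "?Cs ! l \<in> carrier_mat (2 * n) (2 * n)" if "l < n" for l
      using nth[OF that] by simp
    show "(?Cs ! l) $$ (i, j) = 0" if "l < n" "i < 2 * n" "j < 2 * n" "i div 2 \<noteq> j div 2" for l i j
      using that nth[OF that(1)] index[of i j] by simp
    show "(?Cs ! l - (?Cs ! l)\<^sup>T) $$ (2 * i, 2 * i + 1) =
        of_nat (if exponent (e l) i = 1 then 2 else 0)" if "i < n" "l < n" for i l
    proof -
      have "2 * i + 1 < 2 * n" "2 * i < 2 * n" using that by auto
      then have "(rho n (e l) - (rho n (e l))\<^sup>T) $$ (2 * i, 2 * i + 1) =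
          rho n (e l) $$ (2 * i, 2 * i + 1) - rho n (e l) $$ (2 * i + 1, 2 * i)"
        using carrier_matD[OF rho_carrier[of n "e l"]] by simp
      also have "\<dots> = 2 * of_real (sin (pi / 2 * of_int (exponent (e l) i)))"
        using that by (simp add: index turn_def Let_def mat2_def)
      also have "\<dots> = of_nat (if exponent (e l) i = 1 then 2 else 0)"
        unfolding sin[symmetric] by simp
      finally show ?thesis using nth[OF that(2)] by simp
    qed
    show "0 < (if exponent (e i) i = 1 then 2 else 0 :: nat)" if "i < n" for i
      by (simp add: exponent_def e_def)
  qed
qed

text \<open>
  The complex structure \<open>K = A \<oplus> \<dots> \<oplus> A\<close> satisfies
  \<open>2 K = \<rho>(1,0) - \<rho>(3,0) + \<rho>(0,1) + \<rho>(2,1)\<close>, so it commutes with every matrix that commutes with the image.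
\<close>
lemma det_commuting_rho:
  assumes g: "g \<in> carrier_mat (2 * n) (2 * n)" "g * g\<^sup>T = 1\<^sub>m (2 * n)"
    and comm: "\<And>\<gamma>. \<gamma> \<in> carrier Z4_Z4 \<Longrightarrow> g * rho n \<gamma> = rho n \<gamma> * g"
  shows "det g = 1"
proof (rule commuting_orthogonal_det[OF g(1) _ g(2)])
  let ?k = "2 * n"
  define K where "K = blocks n (\<lambda>_. turn 1)"
  define S where "S = rho n (1, 0) - rho n (3, 0) + (rho n (0, 1) + rho n (2, 1))"
  have J: "turn 1 = mat2 0 1 (- 1) 0" "turn 2 = mat2 (- 1) 0 0 (- 1)" "turn 3 = mat2 0 (- 1) 1 0"
    "turn 0 = mat2 1 0 0 1"
    using turn_mult[of 2 1]
    by (simp_all add: turn_0 turn_1 turn_2 J2_mat2 mat2_one mat2_uminus mat2_mult)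
  show K: "K \<in> carrier_mat ?k ?k" by (simp add: K_def)
  have "S = blocks n (\<lambda>i. turn (exponent (1, 0) i) - turn (exponent (3, 0) i)
      + (turn (exponent (0, 1) i) + turn (exponent (2, 1) i)))"
    unfolding S_def rho_def
    by (simp add: diag_block_mat_minus[where d = "\<lambda>_. 2"] diag_block_mat_add[where d = "\<lambda>_. 2"] minus_carrier_mat)
  \<comment> \<open>Block 0 gives A - A^3 + I + A^2, block 2 gives I - I + A + A, and every other
    block A - A^3 + A + A^3. Since A^2 = -I, each of these is 2A.\<close>
  also have "\<dots> = blocks n (\<lambda>i. turn 1 + turn 1)"
    by (rule blocks_cong) (simp add: exponent_def J mat2_add mat2_minus)
  also have "\<dots> = K + K"
    unfolding K_def by (simp add: diag_block_mat_add[where d = "\<lambda>_. 2"])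
  finally have S: "S = K + K" .
  have "g * S = S * g"
    unfolding S_def using g(1) comm[of "(1, 0)"] comm[of "(3, 0)"] comm[of "(0, 1)"] comm[of "(2, 1)"]
    by (simp add: carrier_Z4_Z4 add_mult_distrib_mat[of _ ?k ?k _ _ ?k] minus_carrier_mat
      mult_add_distrib_mat[of _ ?k ?k _ ?k] minus_mult_distrib_mat[of _ ?k ?k _ _ ?k]
      mult_minus_distrib_mat[of _ ?k ?k _ ?k])
  then have eq: "g * K + g * K = K * g + K * g"
    unfolding S using g(1) K by (simp add: add_mult_distrib_mat[of _ ?k ?k _ _ ?k] mult_add_distrib_mat[of _ ?k ?k _ ?k])
  \<comment> \<open>The factor 2 is cancelled entry by entry.\<close>
  show "g * K = K * g"
  proof (rule eq_matI)
    fix i j assume "i < dim_row (K * g)" "j < dim_col (K * g)"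
    moreover from this have "(g * K + g * K) $$ (i, j) = (K * g + K * g) $$ (i, j)"
      by (simp only: eq)
    ultimately show "(g * K) $$ (i, j) = (K * g) $$ (i, j)"
      using g(1) K by (simp del: index_mult_mat(1))
  qed (use g(1) K in auto)
  have "K * K = blocks n (\<lambda>_. - 1\<^sub>m 2)"
    by (simp add: K_def blocks_mult turn_mult turn_2)
  also have "\<dots> = - 1\<^sub>m ?k"
    by (simp flip: blocks_one add: diag_block_mat_uminus comp_def)
  finally show "K * K = - 1\<^sub>m ?k" .
  have "(turn 1)\<^sup>T = - turn 1"
    by (simp add: J mat2_transpose mat2_uminus)
  then show "K\<^sup>T = - K"
    by (simp add: K_def diag_block_mat_transpose diag_block_mat_uminus comp_def)
qed

section \<open>The counterexample to global conjugacy\<close>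

theorem proposition4p5:
  fixes n :: nat
  assumes "n \<ge> 3"
  shows "generate Z4_Z4 {(1, 0), (0, 1)} = carrier Z4_Z4 \<and>
    (\<exists>\<rho> \<in> hom Z4_Z4 (SO (2 * n)). \<rho> (1, 0) = gen10 n \<and> \<rho> (0, 1) = gen01 n) \<and>
    (\<forall>\<rho> \<in> hom Z4_Z4 (SO (2 * n)). \<rho> (1, 0) = gen10 n \<and> \<rho> (0, 1) = gen01 n \<longrightarrow>
       (\<forall>\<gamma> \<in> carrier Z4_Z4. det (\<rho> \<gamma> - (\<rho> \<gamma>)\<^sup>T) = 0) \<and>
       linearized_pfaffian (\<rho> (1, 0) # replicate (n - 1) (\<rho> (0, 1))) \<noteq> 0 \<and>
       (\<exists>\<rho>'. semisimple_rep (2 * n) Z4_Z4 \<rho>' \<and>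
             element_conjugate Z4_Z4 (SO (2 * n)) \<rho>' \<rho> \<and>
             \<not> globally_conjugate Z4_Z4 (SO (2 * n)) \<rho>' \<rho>))"
proof (intro conjI ballI impI; (elim conjE)?)
  show "generate Z4_Z4 {(1, 0), (0, 1)} = carrier Z4_Z4"
    by (rule generate_Z4_Z4)
  show "\<exists>\<rho>\<in>hom Z4_Z4 (SO (2 * n)). \<rho> (1, 0) = gen10 n \<and> \<rho> (0, 1) = gen01 n"
    using rho_hom rho_generators[OF assms] by blast
next
  fix \<rho> assume \<rho>: "\<rho> \<in> hom Z4_Z4 (SO (2 * n))" and gen: "\<rho> (1, 0) = gen10 n" "\<rho> (0, 1) = gen01 n"
  \<comment> \<open>A homomorphism is determined by its values on the two generators, so the
    explicit model \<open>rho n\<close> can stand in for \<open>\<rho>\<close>.\<close>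
  have eq: "\<rho> \<gamma> = rho n \<gamma>" if "\<gamma> \<in> carrier Z4_Z4" for \<gamma>
  proof (rule hom_eq_on_generate[OF group_Z4_Z4 group_SO \<rho> rho_hom])
    show "\<gamma> \<in> generate Z4_Z4 {(1, 0), (0, 1)}"
      using that by (simp add: generate_Z4_Z4)
    show "\<rho> x = rho n x" if "x \<in> {(1, 0), (0, 1)}" for x
      using that gen rho_generators[OF assms] by auto
  qed (simp add: carrier_Z4_Z4)
  show "det (\<rho> \<gamma> - (\<rho> \<gamma>)\<^sup>T) = 0" if "\<gamma> \<in> carrier Z4_Z4" for \<gamma>
    using eq[OF that] det_rho_minus_transpose[OF assms] by simp
  show "linearized_pfaffian (\<rho> (1, 0) # replicate (n - 1) (\<rho> (0, 1))) \<noteq> 0"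
    using linearized_pfaffian_rho[OF assms] rho_generators[OF assms] gen by simp
  define H where "H = block_reflection n 0"
  have H: "H \<in> carrier_mat (2 * n) (2 * n)" "H * H\<^sup>T = 1\<^sub>m (2 * n)" "det H = - 1"
    using assms by (simp_all add: H_def block_reflection_carrier block_reflection_orthogonal det_block_reflection)
  show "\<exists>\<rho>'. semisimple_rep (2 * n) Z4_Z4 \<rho>' \<and> element_conjugate Z4_Z4 (SO (2 * n)) \<rho>' \<rho> \<and>
      \<not> globally_conjugate Z4_Z4 (SO (2 * n)) \<rho>' \<rho>"
  proof (intro exI conjI)
    show "semisimple_rep (2 * n) Z4_Z4 (\<lambda>\<gamma>. H * \<rho> \<gamma> * H\<^sup>T)"
      by (intro semisimple_rep_finite group_Z4_Z4 conj_orthogonal_hom H \<rho>) (simp add: carrier_Z4_Z4)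
    show "element_conjugate Z4_Z4 (SO (2 * n)) (\<lambda>\<gamma>. H * \<rho> \<gamma> * H\<^sup>T) \<rho>"
    proof (rule element_conjugateI[OF H(1,2) \<rho>])
      fix \<gamma> :: "int \<times> int" assume \<gamma>: "\<gamma> \<in> carrier Z4_Z4"
      obtain j where j: "j < 3" "even (exponent \<gamma> j)" using even_exponent by blast
      \<comment> \<open>The correcting matrix is the reflection in a block with even exponent. It
        depends on \<open>\<gamma>\<close>, and its determinant -1 cancels that of
        \<open>H\<close>.\<close>
      with assms have "j < n" by simp
      with j eq[OF \<gamma>] H(3) show "\<exists>C\<in>carrier_mat (2 * n) (2 * n). C * C\<^sup>T = 1\<^sub>m (2 * n) \<and>
          C * \<rho> \<gamma> = \<rho> \<gamma> * C \<and> det H * det C = 1"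
        by (intro bexI[of _ "block_reflection n j"])
          (simp_all add: block_reflection_carrier block_reflection_orthogonal det_block_reflection
            block_reflection_commute)
    qed
    show "\<not> globally_conjugate Z4_Z4 (SO (2 * n)) (\<lambda>\<gamma>. H * \<rho> \<gamma> * H\<^sup>T) \<rho>"
    proof
      assume "globally_conjugate Z4_Z4 (SO (2 * n)) (\<lambda>\<gamma>. H * \<rho> \<gamma> * H\<^sup>T) \<rho>"
      from globally_conjugateD[OF H(1,2) \<rho> this] obtain g where
        g: "g \<in> carrier_mat (2 * n) (2 * n)" "g * g\<^sup>T = 1\<^sub>m (2 * n)" "det g = det H"
        and "\<And>\<gamma>. \<gamma> \<in> carrier Z4_Z4 \<Longrightarrow> g * \<rho> \<gamma> = \<rho> \<gamma> * g" by blast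
      \<comment> \<open>Commuting with the image forces determinant 1, whereas \<open>g\<close> has
        the determinant -1 of \<open>H\<close>.\<close>
      then have "det g = 1"
        by (intro det_commuting_rho[OF g(1,2)]) (simp flip: eq)
      with g(3) H(3) show False by simp
    qed
  qed
qed

end
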